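(* For every $\sigma>0$ there exist positive constants $C_0,C_1,C_2$, depending on $\sigma$ only, such that the following holds. Let $\mu\in(0,1)$ and consider the model $Y_i=\mathbf 1(X_i\in G)+\xi_i$, $i=1,\ldots,n$, with design $X_i=i/n$ and noise satisfying the assumptions in the context with parameter $\sigma$. There exists an estimator $\tilde G_n$ of $G$ such that, for $n$ large enough, $$\sup_{G\in\mathcal S(\mu)}\mathbb P_G\left[|\tilde G_n\triangle G|\ge\frac{x}{n}\right]\le2C_0e^{-\mu x/(256\sigma^2)}+C_1n^4e^{-C_2\mu n/2},\qquad\forall x>0.$$
   Context: The noise terms $\xi_1,\ldots,\xi_n$ are i.i.d. and subgaussian with parameter $\sigma$: $\mathbb E[e^{u\xi_i}]\le e^{\sigma^2u^2/2}$ for all $u\in\mathbb R$. $\mathcal S(\mu)=\{[a,b]:0\le a\le b\le1,\ b-a\ge\mu\}$. $\mathbb P_G$ is the law of the observations when the unknown set is $G$; $|\cdot|$ is Lebesgue measure; $\triangle$ is symmetric difference; $\mathbf 1(\cdot)$ is the indicator function. An estimator $\tilde G_n$ is a subset of $[0,1]$ constructed from the observations $(X_1,Y_1),\ldots,(X_n,Y_n)$. *)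

theory Defs
  imports "HOL-Probability.Probability"
begin

text \<open>Noise is represented by the common law \<open>\<nu>\<close> of the \<open>\<xi>\<^sub>i\<close>. The bound for all real \<open>u\<close>
  forces mean zero. Integrability is required explicitly because the Bochner integral of a
  non-integrable function is \<open>0\<close>, which would make the bound vacuous.\<close>

definition subgaussian_law :: "real \<Rightarrow> real measure \<Rightarrow> bool" where
  "subgaussian_law \<sigma> \<nu> \<longleftrightarrow>
     prob_space \<nu> \<and> sets \<nu> = sets borel \<and>
     (\<forall>u. integrable \<nu> (\<lambda>t. exp (u * t)) \<and>
          (LINT t|\<nu>. exp (u * t)) \<le> exp (\<sigma>\<^sup>2 * u\<^sup>2 / 2))"

definition segments :: "real \<Rightarrow> real set set" where
  "segments \<mu> = {{a..b} | a b. 0 \<le> a \<and> a \<le> b \<and> b \<le> 1 \<and> b - a \<ge> \<mu>}"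

definition design :: "nat \<Rightarrow> nat \<Rightarrow> real" where
  "design n i = real i / real n"

text \<open>A sample \<open>(X\<^sub>1,Y\<^sub>1), \<dots>, (X\<^sub>n,Y\<^sub>n)\<close> is a function on \<open>{1..n}\<close>.\<close>

definition sample_space :: "nat \<Rightarrow> (nat \<Rightarrow> real \<times> real) measure" where
  "sample_space n = (\<Pi>\<^sub>M i\<in>{1..n}. borel)"

definition observe :: "nat \<Rightarrow> real set \<Rightarrow> (nat \<Rightarrow> real) \<Rightarrow> (nat \<Rightarrow> real \<times> real)" where
  "observe n G \<xi> = (\<lambda>i\<in>{1..n}. (design n i, indicator G (design n i) + \<xi> i))"

definition obs_law :: "nat \<Rightarrow> real measure \<Rightarrow> real set \<Rightarrow> (nat \<Rightarrow> real \<times> real) measure" where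
  "obs_law n \<nu> G = distr (\<Pi>\<^sub>M i\<in>{1..n}. \<nu>) (sample_space n) (observe n G)"

text \<open>The measurability clause is the minimal one under which \<open>|T \<triangle> G|\<close> is a random variable,
  so that its tail probabilities make sense. An estimator sees the sample only: neither \<open>G\<close> nor
  the noise law enters.\<close>

definition set_estimator :: "nat \<Rightarrow> ((nat \<Rightarrow> real \<times> real) \<Rightarrow> real set) \<Rightarrow> bool" where
  "set_estimator n T \<longleftrightarrow>
     (\<forall>z\<in>space (sample_space n). T z \<subseteq> {0..1} \<and> T z \<in> sets lebesgue) \<and>
     (\<forall>G\<in>sets lebesgue. G \<subseteq> {0..1} \<longrightarrow>
        (\<lambda>z. measure lebesgue (sym_diff (T z) G)) \<in> borel_measurable (sample_space n))"

lemma observe_measurable: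
  assumes "G \<in> sets borel" "sets \<nu> = sets borel"
  shows "observe n G \<in> measurable (\<Pi>\<^sub>M i\<in>{1..n}. \<nu>) (sample_space n)"
proof -
  have [measurable_cong]: "sets \<nu> = sets borel" by fact
  show ?thesis
    unfolding observe_def sample_space_def borel_prod[symmetric] by measurable
qed

text \<open>\<open>obs_law\<close> is the law of the sample for any i.i.d. noise with marginal law \<open>\<nu>\<close>, on any
  probability space.\<close>

lemma (in prob_space) obs_law_eq_distr:
  assumes "n \<ge> 1" "G \<in> sets borel"
    and indep: "indep_vars (\<lambda>_. borel) \<xi> {1..n}"
    and id: "\<And>i. i \<in> {1..n} \<Longrightarrow> distr M borel (\<xi> i) = \<nu>"
  shows "distr M (sample_space n) (\<lambda>\<omega>. observe n G (\<lambda>i. \<xi> i \<omega>)) = obs_law n \<nu> G"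
proof -
  have rv: "\<And>i. i \<in> {1..n} \<Longrightarrow> random_variable borel (\<xi> i)"
    using indep by (auto simp: indep_vars_def)
  have sets_nu: "sets \<nu> = sets borel"
    using id[of 1] \<open>n \<ge> 1\<close> by (metis atLeastAtMost_iff le_refl sets_distr)
  define R where "R = (\<lambda>\<omega>. \<lambda>i\<in>{1..n}. \<xi> i \<omega>)"
  have R: "R \<in> measurable M (\<Pi>\<^sub>M i\<in>{1..n}. borel)"
    unfolding R_def by (intro measurable_restrict rv)
  have marg: "(\<Pi>\<^sub>M i\<in>{1..n}. distr M borel (\<xi> i)) = (\<Pi>\<^sub>M i\<in>{1..n}. \<nu>)"
    by (rule PiM_cong) (use id in auto)
  have law: "distr M (\<Pi>\<^sub>M i\<in>{1..n}. borel) R = (\<Pi>\<^sub>M i\<in>{1..n}. \<nu>)"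
    using indep_vars_iff_distr_eq_PiM'[where I = "{1..n}" and M' = "\<lambda>_. borel" and X = \<xi>] indep rv \<open>n \<ge> 1\<close>
    by (simp add: R_def marg[simplified])
  have "(\<lambda>\<omega>. observe n G (\<lambda>i. \<xi> i \<omega>)) = observe n G \<circ> R"
    by (auto simp: observe_def R_def fun_eq_iff)
  then show ?thesis
    unfolding obs_law_def law[symmetric]
    using observe_measurable[OF \<open>G \<in> sets borel\<close>, of borel n] R
    by (simp add: distr_distr)
qed

end

theory Submission
  imports Defs
begin

text \<open>The estimator is least squares over segments with endpoints in the design: the residual
  sum of squares of the fit \<open>\<one>\<^sub>I\<close> is a constant minus \<open>2 (\<Sum>\<^sub>i\<^sub>\<in>\<^sub>I (Y\<^sub>i - 1/2))\<close>, so it picks the index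
  segment \<open>I = {i..j}\<close> of largest score \<open>\<Sum>\<^sub>l\<^sub>\<in>\<^sub>I (Y\<^sub>l - 1/2)\<close>.

  Let \<open>I\<^sub>0 = {p..q}\<close> be the design indices that fall into \<open>G\<close>, and \<open>k = |I \<triangle> I\<^sub>0|\<close>. The score of
  \<open>I\<close> exceeds that of \<open>I\<^sub>0\<close> by \<open>-k/2\<close> plus a sum of \<open>k\<close> noise terms with signs
  (\<open>segment_score_observe_diff\<close>), so by Chernoff's inequality \<open>I\<close> beats \<open>I\<^sub>0\<close> with probability at
  most \<open>exp (-k/(8\<sigma>\<^sup>2))\<close> (\<open>segment_score_overtake_tail\<close>).

  Two regimes produce the two terms of the bound. If \<open>I\<close> meets \<open>I\<^sub>0\<close>, then \<open>k\<close> is the distance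
  \<open>d = |i - p| + |j - q|\<close>. In the union bound over all such \<open>I\<close> with \<open>d \<ge> m\<close>, half of the exponent
  gives the factor \<open>exp (-m/(16\<sigma>\<^sup>2))\<close>, and the other half makes the sum over \<open>(i, j)\<close> a product of
  two geometric series, bounded by a constant that depends on \<open>\<sigma>\<close> only. If \<open>I\<close> misses \<open>I\<^sub>0\<close>, then
  \<open>k \<ge> |I\<^sub>0| \<ge> n\<mu> - 1\<close>, and there are at most \<open>n\<^sup>2\<close> such \<open>I\<close>, which contributes a multiple of
  \<open>n\<^sup>2 exp (-n\<mu>/(8\<sigma>\<^sup>2))\<close> (\<open>best_pair_dist_tail\<close>).

  Each endpoint of \<open>G\<close> lies within \<open>1/n\<close> of the corresponding design point of \<open>I\<^sub>0\<close>. Hence a loss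
  of at least \<open>x/n\<close> forces \<open>d \<ge> x - 2\<close>, and the shift by \<open>2\<close> only changes the constant. The
  resulting rate \<open>x/(16\<sigma>\<^sup>2)\<close> is better than \<open>\<mu>x/(256\<sigma>\<^sup>2)\<close> because \<open>\<mu> < 1\<close>.\<close>

section \<open>Subgaussian noise\<close>

lemma subgaussian_law_product_prob_space:
  assumes "subgaussian_law \<sigma> \<nu>"
  shows "prob_space (\<Pi>\<^sub>M i\<in>I. \<nu>)"
  using assms by (intro prob_space_PiM) (simp add: subgaussian_law_def)

text \<open>Chernoff's bound with a free parameter \<open>u\<close>; the moment generating function of the weighted
  sum factorises by independence, which here is the product structure of the noise measure.\<close>

lemma subgaussian_sum_tail:
  fixes c :: "nat \<Rightarrow> real"
  assumes \<nu>: "subgaussian_law \<sigma> \<nu>" and "finite I" "u > 0"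
  shows "measure (\<Pi>\<^sub>M i\<in>I. \<nu>) {\<xi> \<in> space (\<Pi>\<^sub>M i\<in>I. \<nu>). (\<Sum>i\<in>I. c i * \<xi> i) \<ge> t}
           \<le> exp (\<sigma>\<^sup>2 * u\<^sup>2 / 2 * (\<Sum>i\<in>I. (c i)\<^sup>2) - u * t)"
proof -
  define N where "N = (\<Pi>\<^sub>M i\<in>I. \<nu>)"
  interpret N: prob_space N
    unfolding N_def using \<nu> by (rule subgaussian_law_product_prob_space)
  interpret \<nu>: prob_space \<nu>
    using \<nu> by (simp add: subgaussian_law_def)
  interpret P: product_sigma_finite "\<lambda>_. \<nu>"
    by unfold_locales
  have [measurable_cong]: "sets \<nu> = sets borel"
    using \<nu> by (simp add: subgaussian_law_def)
  have int: "integrable \<nu> (\<lambda>y. exp (u * c i * y))"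
    and mgf: "(LINT y|\<nu>. exp (u * c i * y)) \<le> exp (\<sigma>\<^sup>2 * (u * c i)\<^sup>2 / 2)" for i
    using \<nu> by (auto simp: subgaussian_law_def)
  have split: "exp (u * (\<Sum>i\<in>I. c i * \<xi> i)) = (\<Prod>i\<in>I. exp (u * c i * \<xi> i))" for \<xi>
    by (simp add: exp_sum \<open>finite I\<close> sum_distrib_left mult.assoc)
  have intN: "integrable N (\<lambda>\<xi>. exp (u * (\<Sum>i\<in>I. c i * \<xi> i)))"
    unfolding split N_def using int by (intro P.product_integrable_prod \<open>finite I\<close>)
  have [measurable]: "(\<lambda>\<xi>. \<Sum>i\<in>I. c i * \<xi> i) \<in> borel_measurable N"
    unfolding N_def by measurable
  have "set_integrable N (space N) (\<lambda>\<xi>. exp (u * (\<Sum>i\<in>I. c i * \<xi> i)))"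
    unfolding set_integrable_def by (rule integrable_mult_indicator[OF sets.top intN])
  then have "measure N {\<xi> \<in> space N. (\<Sum>i\<in>I. c i * \<xi> i) \<ge> t}
        \<le> exp (- u * t) * N.expectation (\<lambda>\<xi>. exp (u * (\<Sum>i\<in>I. c i * \<xi> i)))"
    using N.Chernoff_ineq_ge[of u "space N" "\<lambda>\<xi>. \<Sum>i\<in>I. c i * \<xi> i" t] \<open>u > 0\<close> intN
    by (simp add: set_integral_space)
  also have "N.expectation (\<lambda>\<xi>. exp (u * (\<Sum>i\<in>I. c i * \<xi> i))) = (\<Prod>i\<in>I. LINT y|\<nu>. exp (u * c i * y))"
    unfolding split N_def using int by (intro P.product_integral_prod \<open>finite I\<close>)
  also have "\<dots> \<le> (\<Prod>i\<in>I. exp (\<sigma>\<^sup>2 * (u * c i)\<^sup>2 / 2))"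
    by (intro prod_mono conjI mgf integral_nonneg_AE) auto
  also have "\<dots> = exp (\<sigma>\<^sup>2 * u\<^sup>2 / 2 * (\<Sum>i\<in>I. (c i)\<^sup>2))"
    by (simp add: exp_sum[symmetric] \<open>finite I\<close> sum_distrib_left power_mult_distrib mult_ac)
  also have "exp (- u * t) * exp (\<sigma>\<^sup>2 * u\<^sup>2 / 2 * (\<Sum>i\<in>I. (c i)\<^sup>2))
      = exp (\<sigma>\<^sup>2 * u\<^sup>2 / 2 * (\<Sum>i\<in>I. (c i)\<^sup>2) - u * t)"
    by (simp add: exp_add[symmetric])
  finally show ?thesis
    unfolding N_def by simp
qed

section \<open>Least squares over index segments\<close>

definition segment_score :: "(nat \<Rightarrow> real \<times> real) \<Rightarrow> nat \<Rightarrow> nat \<Rightarrow> real" where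
  "segment_score z i j = (\<Sum>l\<in>{i..j}. snd (z l) - 1 / 2)"

definition index_pairs :: "nat \<Rightarrow> (nat \<times> nat) set" where
  "index_pairs n = {(i, j). 1 \<le> i \<and> i \<le> j \<and> j \<le> n}"

text \<open>A maximiser of the score over \<open>index_pairs\<close>. Ties are broken by the least code of a pair
  rather than by an arbitrary choice, so that the selection is measurable in the sample.\<close>

definition best_pair :: "nat \<Rightarrow> (nat \<Rightarrow> real \<times> real) \<Rightarrow> nat \<times> nat" where
  "best_pair n z = prod_decode (LEAST k. prod_decode k \<in> index_pairs n \<and>
     (\<forall>(i, j)\<in>index_pairs n.
        segment_score z i j \<le> segment_score z (fst (prod_decode k)) (snd (prod_decode k))))"

text \<open>The intersection makes the containment in \<open>{0..1}\<close> immediate for every \<open>n\<close>, including \<open>n = 0\<close>,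
  where there are no index pairs and \<open>best_pair\<close> is unspecified.\<close>

definition segment_estimator :: "nat \<Rightarrow> (nat \<Rightarrow> real \<times> real) \<Rightarrow> real set" where
  "segment_estimator n z =
     {design n (fst (best_pair n z))..design n (snd (best_pair n z))} \<inter> {0..1}"

lemma finite_index_pairs [simp]: "finite (index_pairs n)"
  by (rule finite_subset[of _ "{1..n} \<times> {1..n}"]) (auto simp: index_pairs_def)

lemma best_pair_maximises:
  assumes "n \<ge> 1"
  shows "best_pair n z \<in> index_pairs n"
    and "(i, j) \<in> index_pairs n \<Longrightarrow>
           segment_score z i j \<le> segment_score z (fst (best_pair n z)) (snd (best_pair n z))"
proof -
  define P where "P k \<longleftrightarrow> prod_decode k \<in> index_pairs n \<and> (\<forall>(i, j)\<in>index_pairs n.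
    segment_score z i j \<le> segment_score z (fst (prod_decode k)) (snd (prod_decode k)))" for k
  define f where "f = (\<lambda>(i, j). segment_score z i j)"
  have "(1, 1) \<in> index_pairs n"
    using assms by (simp add: index_pairs_def)
  then have "Max (f ` index_pairs n) \<in> f ` index_pairs n"
    by (intro Max_in) auto
  then obtain s where s: "s \<in> index_pairs n" "f s = Max (f ` index_pairs n)"
    by force
  have "f w \<le> f s" if "w \<in> index_pairs n" for w
    using that s by simp
  then have "P (prod_encode s)"
    using s(1) unfolding P_def f_def by (auto simp: case_prod_beta)
  then have "P (LEAST k. P k)"
    by (rule LeastI)
  then show "best_pair n z \<in> index_pairs n"
    and "(i, j) \<in> index_pairs n \<Longrightarrow>
           segment_score z i j \<le> segment_score z (fst (best_pair n z)) (snd (best_pair n z))"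
    unfolding best_pair_def P_def by auto
qed

lemma measurable_segment_score:
  assumes "(i, j) \<in> index_pairs n"
  shows "(\<lambda>z. segment_score z i j) \<in> borel_measurable (sample_space n)"
  unfolding segment_score_def
proof (intro borel_measurable_sum borel_measurable_diff borel_measurable_const)
  fix l assume "l \<in> {i..j}"
  with assms have "l \<in> {1..n}"
    by (auto simp: index_pairs_def)
  then have "(\<lambda>z. z l) \<in> measurable (sample_space n) borel"
    unfolding sample_space_def by (rule measurable_component_singleton)
  then show "(\<lambda>z. snd (z l)) \<in> borel_measurable (sample_space n)"
    by (rule measurable_compose) (intro borel_measurable_continuous_onI continuous_intros)
qed

lemma measurable_best_pair:
  "best_pair n \<in> measurable (sample_space n) (count_space UNIV)"
proof -
  have "Measurable.pred (sample_space n) (\<lambda>z. prod_decode k \<in> index_pairs n \<and>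
     (\<forall>s\<in>index_pairs n. case s of (i, j) \<Rightarrow>
        segment_score z i j \<le> segment_score z (fst (prod_decode k)) (snd (prod_decode k))))" for k
  proof (cases "prod_decode k \<in> index_pairs n")
    case True
    have score: "(\<lambda>z. segment_score z (fst s) (snd s)) \<in> borel_measurable (sample_space n)"
      if "s \<in> index_pairs n" for s
      using that by (intro measurable_segment_score) simp
    have compare: "Measurable.pred (sample_space n) (\<lambda>z. segment_score z (fst s) (snd s)
        \<le> segment_score z (fst (prod_decode k)) (snd (prod_decode k)))" if "s \<in> index_pairs n" for s
      using score[OF that] score[OF True] unfolding Measurable.pred_def by (rule borel_measurable_le)
    show ?thesis
      unfolding case_prod_beta using True by simp (intro pred_intros_finite finite_index_pairs compare)
  qed simp
  then have "(\<lambda>z. LEAST k. prod_decode k \<in> index_pairs n \<and>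
     (\<forall>(i, j)\<in>index_pairs n.
        segment_score z i j \<le> segment_score z (fst (prod_decode k)) (snd (prod_decode k))))
     \<in> measurable (sample_space n) (count_space UNIV)"
    by (rule measurable_Least)
  then show ?thesis
    unfolding best_pair_def[abs_def] by (rule measurable_compose) simp
qed

text \<open>The estimator depends on the sample only through \<open>best_pair\<close>, which takes values in a discrete
  space, so any function of it is a random variable.\<close>

lemma set_estimator_segment_estimator: "set_estimator n (segment_estimator n)"
  unfolding set_estimator_def
proof (intro conjI ballI allI impI)
  fix G :: "real set"
  show "(\<lambda>z. measure lebesgue (sym_diff (segment_estimator n z) G)) \<in> borel_measurable (sample_space n)"
    unfolding segment_estimator_def
    by (rule measurable_compose[OF measurable_best_pair,
          where g = "\<lambda>s. measure lebesgue (sym_diff ({design n (fst s)..design n (snd s)} \<inter> {0..1}) G)"])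
       simp
qed (auto simp: segment_estimator_def)

lemma sum_indicator_card_subset:
  assumes "finite A" "B \<subseteq> A"
  shows "(\<Sum>x\<in>A. indicator B x) = real (card B)"
  using assms by (simp add: sum.If_cases indicator_def Int_absorb1)

section \<open>Comparing two index segments\<close>

definition index_dist :: "nat \<times> nat \<Rightarrow> nat \<Rightarrow> nat \<Rightarrow> real" where
  "index_dist s p q = \<bar>real (fst s) - real p\<bar> + \<bar>real (snd s) - real q\<bar>"

text \<open>Two overlapping segments differ exactly between their left endpoints and between their right
  endpoints. For disjoint segments the distance of the endpoints can exceed the size of the symmetric
  difference, but then the latter contains all of \<open>{p..q}\<close>.\<close>

lemma card_sym_diff_segments:
  fixes i j p q :: nat
  assumes "i \<le> j" "p \<le> q"
  shows "real (card (sym_diff {i..j} {p..q})) \<ge> min (index_dist (i, j) p q) (real q - real p + 1)"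
proof (cases "max i p \<le> min j q")
  case True
  let ?A = "{min i p..<max i p}" and ?B = "{min j q<..max j q}"
  have "?A \<union> ?B \<subseteq> sym_diff {i..j} {p..q}"
    using True by auto
  then have "card (?A \<union> ?B) \<le> card (sym_diff {i..j} {p..q})"
    by (intro card_mono) auto
  also have "card (?A \<union> ?B) = card ?A + card ?B"
    using True by (intro card_Un_disjoint) auto
  finally have "real (card ?A + card ?B) \<le> real (card (sym_diff {i..j} {p..q}))"
    by (simp only: of_nat_le_iff)
  also have "real (card ?A + card ?B) = index_dist (i, j) p q"
    by (auto simp: index_dist_def of_nat_diff min_def max_def)
  finally show ?thesis
    by simp
next
  case False
  then have "{p..q} \<subseteq> sym_diff {i..j} {p..q}"
    using assms by auto
  then have "card {p..q} \<le> card (sym_diff {i..j} {p..q})"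
    by (intro card_mono) auto
  then show ?thesis
    using assms by auto
qed

text \<open>Subtracting \<open>1/2\<close> from each observation makes its mean \<open>1/2\<close> inside the true segment and
  \<open>-1/2\<close> outside. So every index on which \<open>{i..j}\<close> is wrong, of either kind, costs \<open>1/2\<close> in
  expectation, and the noise cancels on all others.\<close>

lemma segment_score_observe_diff:
  assumes "(i, j) \<in> index_pairs n" "(p, q) \<in> index_pairs n"
    and G: "\<And>l. l \<in> {1..n} \<Longrightarrow> design n l \<in> G \<longleftrightarrow> l \<in> {p..q}"
  shows "segment_score (observe n G \<xi>) i j - segment_score (observe n G \<xi>) p q =
     (\<Sum>l\<in>{1..n}. (indicator {i..j} l - indicator {p..q} l) * \<xi> l)
       - real (card (sym_diff {i..j} {p..q})) / 2"
proof -
  have score: "segment_score (observe n G \<xi>) r s =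
      (\<Sum>l\<in>{1..n}. indicator {r..s} l * (indicator {p..q} l + \<xi> l - 1 / 2))"
    if "(r, s) \<in> index_pairs n" for r s
  proof -
    have "segment_score (observe n G \<xi>) r s = (\<Sum>l\<in>{r..s}. indicator {p..q} l + \<xi> l - 1 / 2)"
      unfolding segment_score_def using that G
      by (intro sum.cong) (auto simp: observe_def index_pairs_def indicator_def)
    also have "\<dots> = (\<Sum>l\<in>{1..n}. indicator {r..s} l * (indicator {p..q} l + \<xi> l - 1 / 2))"
      using that by (intro sum.mono_neutral_cong_left) (auto simp: index_pairs_def)
    finally show ?thesis .
  qed
  have card: "(\<Sum>l\<in>{1..n}. indicator (sym_diff {i..j} {p..q}) l) = real (card (sym_diff {i..j} {p..q}))"
    using assms(1,2) by (subst sum_indicator_card_subset) (auto simp: index_pairs_def)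
  have pointwise: "indicator A l * (indicator B l + y - 1 / 2) - indicator B l * (indicator B l + y - 1 / 2)
      = (indicator A l - indicator B l) * y - indicator (sym_diff A B) l / 2"
    for A B :: "nat set" and l and y :: real
    by (cases "l \<in> A"; cases "l \<in> B") (simp_all add: algebra_simps)
  show ?thesis
    unfolding score[OF assms(1)] score[OF assms(2)] card[symmetric] sum_divide_distrib
      sum_subtractf[symmetric]
    by (intro sum.cong refl pointwise)
qed

lemma segment_score_overtake_tail:
  assumes \<nu>: "subgaussian_law \<sigma> \<nu>" and "\<sigma> > 0"
    and ij: "(i, j) \<in> index_pairs n" and pq: "(p, q) \<in> index_pairs n"
    and G: "\<And>l. l \<in> {1..n} \<Longrightarrow> design n l \<in> G \<longleftrightarrow> l \<in> {p..q}"
  shows "measure (\<Pi>\<^sub>M i\<in>{1..n}. \<nu>) {\<xi> \<in> space (\<Pi>\<^sub>M i\<in>{1..n}. \<nu>).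
            segment_score (observe n G \<xi>) p q \<le> segment_score (observe n G \<xi>) i j}
         \<le> exp (- real (card (sym_diff {i..j} {p..q})) / (8 * \<sigma>\<^sup>2))"
proof -
  define k where "k = real (card (sym_diff {i..j} {p..q}))"
  define c where "c l = (indicator {i..j} l - indicator {p..q} l :: real)" for l
  have pointwise: "(indicator A l - indicator B l :: real)\<^sup>2 = indicator (sym_diff A B) l"
    for A B :: "nat set" and l
    by (cases "l \<in> A"; cases "l \<in> B") simp_all
  have "(\<Sum>l\<in>{1..n}. (c l)\<^sup>2) = (\<Sum>l\<in>{1..n}. indicator (sym_diff {i..j} {p..q}) l)"
    unfolding c_def by (intro sum.cong refl pointwise)
  also have "\<dots> = k"
    unfolding k_def using ij pq
    by (subst sum_indicator_card_subset) (auto simp: index_pairs_def)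
  finally have sq: "(\<Sum>l\<in>{1..n}. (c l)\<^sup>2) = k" .
  have "{\<xi> \<in> space (\<Pi>\<^sub>M i\<in>{1..n}. \<nu>).
            segment_score (observe n G \<xi>) p q \<le> segment_score (observe n G \<xi>) i j}
      = {\<xi> \<in> space (\<Pi>\<^sub>M i\<in>{1..n}. \<nu>). (\<Sum>l\<in>{1..n}. c l * \<xi> l) \<ge> k / 2}"
  proof (intro Collect_cong conj_cong refl)
    fix \<xi>
    have "segment_score (observe n G \<xi>) i j - segment_score (observe n G \<xi>) p q
        = (\<Sum>l\<in>{1..n}. c l * \<xi> l) - k / 2"
      unfolding c_def k_def using ij pq G by (rule segment_score_observe_diff)
    then show "segment_score (observe n G \<xi>) p q \<le> segment_score (observe n G \<xi>) i j
        \<longleftrightarrow> (\<Sum>l\<in>{1..n}. c l * \<xi> l) \<ge> k / 2"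
      by linarith
  qed
  \<comment> \<open>\<open>u = 1 / (2 \<sigma>\<^sup>2)\<close> minimises the exponent \<open>\<sigma>\<^sup>2 u\<^sup>2 k / 2 - u k / 2\<close>.\<close>
  moreover have "\<sigma>\<^sup>2 * (1 / (2 * \<sigma>\<^sup>2))\<^sup>2 / 2 * k - 1 / (2 * \<sigma>\<^sup>2) * (k / 2) = - k / (8 * \<sigma>\<^sup>2)"
    using \<open>\<sigma> > 0\<close> by (simp add: field_simps power2_eq_square)
  ultimately show ?thesis
    using subgaussian_sum_tail[OF \<nu>, of "{1..n}" "1 / (2 * \<sigma>\<^sup>2)" "k / 2" c] \<open>\<sigma> > 0\<close>
    unfolding sq k_def by simp
qed

section \<open>Deviation of the selected indices\<close>

text \<open>A two-sided geometric series. That the bound is uniform in \<open>S\<close> and \<open>p\<close> keeps the number of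
  candidate segments out of the final constant.\<close>

lemma sum_exp_dist_le:
  fixes \<beta> :: real
  assumes "\<beta> > 0" "finite S"
  shows "(\<Sum>i\<in>S. exp (- \<beta> * \<bar>real i - real p\<bar>)) \<le> 2 / (1 - exp (- \<beta>))"
proof -
  define r where "r = exp (- \<beta>)"
  have r: "0 < r" "r < 1"
    using assms by (auto simp: r_def)
  have geo: "(\<Sum>i\<in>A. r ^ f i) \<le> 1 / (1 - r)" if "finite A" "inj_on f A" for A :: "nat set" and f
  proof -
    have "(\<Sum>i\<in>A. r ^ f i) = (\<Sum>k\<in>f ` A. r ^ k)"
      using that by (simp add: sum.reindex)
    also have "\<dots> \<le> (\<Sum>k. r ^ k)"
      using r that by (intro sum_le_suminf summable_geometric) auto
    finally show ?thesis
      using r by (simp add: suminf_geometric)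
  qed
  have "(\<Sum>i\<in>S. exp (- \<beta> * \<bar>real i - real p\<bar>))
      = (\<Sum>i\<in>S \<inter> {..<p}. exp (- \<beta> * \<bar>real i - real p\<bar>)) + (\<Sum>i\<in>S - {..<p}. exp (- \<beta> * \<bar>real i - real p\<bar>))"
    using \<open>finite S\<close> by (rule sum.Int_Diff)
  also have "(\<Sum>i\<in>S \<inter> {..<p}. exp (- \<beta> * \<bar>real i - real p\<bar>)) = (\<Sum>i\<in>S \<inter> {..<p}. r ^ (p - i))"
    by (intro sum.cong) (auto simp: r_def exp_of_nat_mult[symmetric] of_nat_diff algebra_simps)
  also have "(\<Sum>i\<in>S - {..<p}. exp (- \<beta> * \<bar>real i - real p\<bar>)) = (\<Sum>i\<in>S - {..<p}. r ^ (i - p))"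
    by (intro sum.cong) (auto simp: r_def exp_of_nat_mult[symmetric] of_nat_diff algebra_simps)
  finally show ?thesis
    using geo[of "S \<inter> {..<p}" "\<lambda>i. p - i"] geo[of "S - {..<p}" "\<lambda>i. i - p"] \<open>finite S\<close>
    by (fastforce simp: inj_on_def r_def)
qed

text \<open>Half of the exponent pays for the deviation \<open>m\<close>, the other half stays summable in \<open>d\<close>.\<close>

lemma exp_min_split:
  fixes \<alpha> d m L :: real
  assumes "\<alpha> \<ge> 0" "d \<ge> m"
  shows "exp (- \<alpha> * min d L) \<le> exp (- \<alpha> / 2 * m) * exp (- \<alpha> / 2 * d) + exp (- \<alpha> * L)"
proof (cases "d \<le> L")
  case True
  have "\<alpha> / 2 * m \<le> \<alpha> / 2 * d"
    using assms by (intro mult_left_mono) auto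
  then have "exp (- \<alpha> * d) \<le> exp (- \<alpha> / 2 * m) * exp (- \<alpha> / 2 * d)"
    by (simp add: exp_add[symmetric])
  then show ?thesis
    using True by (simp add: add_increasing2)
qed simp

text \<open>If the selected pair is far from \<open>(p, q)\<close>, then some far pair has a score at least that of
  \<open>(p, q)\<close>; the probability of this is bounded by a sum over the far pairs.\<close>

lemma best_pair_dist_tail:
  assumes \<nu>: "subgaussian_law \<sigma> \<nu>" and "\<sigma> > 0"
    and pq: "(p, q) \<in> index_pairs n"
    and G: "\<And>l. l \<in> {1..n} \<Longrightarrow> design n l \<in> G \<longleftrightarrow> l \<in> {p..q}" and "G \<in> sets borel"
  shows "measure (\<Pi>\<^sub>M i\<in>{1..n}. \<nu>)
           {\<xi> \<in> space (\<Pi>\<^sub>M i\<in>{1..n}. \<nu>). index_dist (best_pair n (observe n G \<xi>)) p q \<ge> m}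
         \<le> (2 / (1 - exp (- 1 / (16 * \<sigma>\<^sup>2))))\<^sup>2 * exp (- m / (16 * \<sigma>\<^sup>2))
            + (real n)\<^sup>2 * exp (- (real q - real p + 1) / (8 * \<sigma>\<^sup>2))"
proof -
  define N where "N = (\<Pi>\<^sub>M i\<in>{1..n}. \<nu>)"
  define \<alpha> where "\<alpha> = 1 / (8 * \<sigma>\<^sup>2)"
  define L where "L = real q - real p + 1"
  define far where "far = {s \<in> index_pairs n. index_dist s p q \<ge> m}"
  define overtake where "overtake s = {\<xi> \<in> space N. segment_score (observe n G \<xi>) p q
      \<le> segment_score (observe n G \<xi>) (fst s) (snd s)}" for s
  define e where "e i r = exp (- (\<alpha> / 2) * \<bar>real i - real r\<bar>)" for i r :: nat
  have "\<alpha> > 0"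
    using \<open>\<sigma> > 0\<close> by (simp add: \<alpha>_def)
  have "n \<ge> 1"
    using pq by (auto simp: index_pairs_def)
  interpret N: prob_space N
    unfolding N_def using \<nu> by (rule subgaussian_law_product_prob_space)
  have obs: "observe n G \<in> measurable N (sample_space n)"
    unfolding N_def using \<nu> \<open>G \<in> sets borel\<close>
    by (intro observe_measurable) (auto simp: subgaussian_law_def)
  have meas: "overtake s \<in> sets N" if "s \<in> index_pairs n" for s
  proof -
    have [measurable]: "(\<lambda>\<xi>. segment_score (observe n G \<xi>) (fst s) (snd s)) \<in> borel_measurable N"
      using that by (intro measurable_compose[OF obs] measurable_segment_score) simp
    have [measurable]: "(\<lambda>\<xi>. segment_score (observe n G \<xi>) p q) \<in> borel_measurable N"
      using pq by (intro measurable_compose[OF obs] measurable_segment_score)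
    show ?thesis
      unfolding overtake_def by measurable
  qed
  have prob: "measure N (overtake s) \<le> exp (- \<alpha> / 2 * m) * (e (fst s) p * e (snd s) q) + exp (- \<alpha> * L)"
    if "s \<in> far" for s
  proof -
    have s: "(fst s, snd s) \<in> index_pairs n" "index_dist s p q \<ge> m"
      using that by (auto simp: far_def)
    have "measure N (overtake s) \<le> exp (- real (card (sym_diff {fst s..snd s} {p..q})) / (8 * \<sigma>\<^sup>2))"
      unfolding N_def overtake_def by (rule segment_score_overtake_tail[OF \<nu> \<open>\<sigma> > 0\<close> s(1) pq G])
    also have "\<dots> = exp (- \<alpha> * real (card (sym_diff {fst s..snd s} {p..q})))"
      by (simp add: \<alpha>_def)
    also have "\<dots> \<le> exp (- \<alpha> * min (index_dist s p q) L)"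
      using card_sym_diff_segments[of "fst s" "snd s" p q] s pq \<open>\<alpha> > 0\<close>
      by (simp add: L_def index_pairs_def case_prod_beta)
    also have "\<dots> \<le> exp (- \<alpha> / 2 * m) * exp (- \<alpha> / 2 * index_dist s p q) + exp (- \<alpha> * L)"
      using \<open>\<alpha> > 0\<close> s by (intro exp_min_split) auto
    also have "exp (- \<alpha> / 2 * index_dist s p q) = e (fst s) p * e (snd s) q"
      by (simp add: e_def index_dist_def exp_add[symmetric] algebra_simps)
    finally show ?thesis .
  qed
  have far: "far \<subseteq> {1..n} \<times> {1..n}"
    by (auto simp: far_def index_pairs_def)
  then have "finite far"
    by (rule finite_subset) simp
  have "{\<xi> \<in> space N. index_dist (best_pair n (observe n G \<xi>)) p q \<ge> m} \<subseteq> (\<Union>s\<in>far. overtake s)"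
  proof
    fix \<xi> assume "\<xi> \<in> {\<xi> \<in> space N. index_dist (best_pair n (observe n G \<xi>)) p q \<ge> m}"
    then have "best_pair n (observe n G \<xi>) \<in> far" "\<xi> \<in> overtake (best_pair n (observe n G \<xi>))"
      using best_pair_maximises[OF \<open>n \<ge> 1\<close>] pq by (simp_all add: far_def overtake_def)
    then show "\<xi> \<in> (\<Union>s\<in>far. overtake s)"
      by blast
  qed
  then have "measure N {\<xi> \<in> space N. index_dist (best_pair n (observe n G \<xi>)) p q \<ge> m}
      \<le> measure N (\<Union>s\<in>far. overtake s)"
    using meas by (intro N.finite_measure_mono sets.finite_UN \<open>finite far\<close>) (auto simp: far_def)
  also have "\<dots> \<le> (\<Sum>s\<in>far. measure N (overtake s))"
    using meas \<open>finite far\<close> by (intro N.finite_measure_subadditive_finite) (auto simp: far_def)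
  also have "\<dots> \<le> (\<Sum>s\<in>far. exp (- \<alpha> / 2 * m) * (e (fst s) p * e (snd s) q) + exp (- \<alpha> * L))"
    by (intro sum_mono prob)
  also have "\<dots> \<le> (\<Sum>s\<in>{1..n} \<times> {1..n}. exp (- \<alpha> / 2 * m) * (e (fst s) p * e (snd s) q) + exp (- \<alpha> * L))"
    by (intro sum_mono2 far) (auto simp: e_def)
  also have "\<dots> = exp (- \<alpha> / 2 * m) * ((\<Sum>i\<in>{1..n}. e i p) * (\<Sum>j\<in>{1..n}. e j q)) + (real n)\<^sup>2 * exp (- \<alpha> * L)"
  proof -
    have "(\<Sum>i\<in>{1..n}. e i p) * (\<Sum>j\<in>{1..n}. e j q) = (\<Sum>s\<in>{1..n} \<times> {1..n}. e (fst s) p * e (snd s) q)"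
      by (simp add: sum_product sum.cartesian_product case_prod_beta)
    then show ?thesis
      by (simp add: sum.distrib sum_distrib_left[symmetric] power2_eq_square)
  qed
  also have "(\<Sum>i\<in>{1..n}. e i p) * (\<Sum>j\<in>{1..n}. e j q)
      \<le> 2 / (1 - exp (- (\<alpha> / 2))) * (2 / (1 - exp (- (\<alpha> / 2))))"
    unfolding e_def using \<open>\<alpha> > 0\<close> by (intro mult_mono sum_exp_dist_le sum_nonneg) auto
  finally show ?thesis
    unfolding N_def L_def[symmetric] by (simp add: \<alpha>_def power2_eq_square mult.commute)
qed

section \<open>From indices to segments of the unit interval\<close>

text \<open>A point on which two intervals disagree lies between the two left or between the two right
  endpoints. The summand \<open>2\<close> is the rounding error of the endpoints of \<open>{a..b}\<close> to the design.\<close>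

lemma measure_sym_diff_segment_estimator_le:
  fixes a b :: real
  assumes "0 \<le> a" "b \<le> 1" "n \<ge> 1"
    and "\<bar>real n * a - real p\<bar> \<le> 1" "\<bar>real n * b - real q\<bar> \<le> 1"
  shows "measure lebesgue (sym_diff (segment_estimator n z) {a..b})
           \<le> (index_dist (best_pair n z) p q + 2) / real n"
proof -
  define i j where "i = fst (best_pair n z)" and "j = snd (best_pair n z)"
  define A where "A = {min (design n i) a..max (design n i) a}"
  define B where "B = {min (design n j) b..max (design n j) b}"
  have "sym_diff (segment_estimator n z) {a..b} \<subseteq> A \<union> B"
    using assms by (auto simp: segment_estimator_def A_def B_def i_def j_def)
  then have "measure lebesgue (sym_diff (segment_estimator n z) {a..b}) \<le> measure lebesgue (A \<union> B)"
    by (intro measure_mono_fmeasurable) (auto simp: A_def B_def segment_estimator_def)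
  also have "\<dots> \<le> measure lebesgue A + measure lebesgue B"
    by (intro measure_Un_le) (auto simp: A_def B_def)
  also have "\<dots> = \<bar>design n i - a\<bar> + \<bar>design n j - b\<bar>"
    by (auto simp: A_def B_def min_def max_def)
  also have "\<dots> = (\<bar>real i - real n * a\<bar> + \<bar>real j - real n * b\<bar>) / real n"
  proof -
    have "\<bar>design n k - c\<bar> = \<bar>real k - real n * c\<bar> / real n" for k c
      using \<open>n \<ge> 1\<close> by (subst abs_div_pos) (auto simp: design_def field_simps)
    then show ?thesis
      by (simp add: add_divide_distrib)
  qed
  also have "\<dots> \<le> (index_dist (best_pair n z) p q + 2) / real n"
    using assms by (intro divide_right_mono) (auto simp: index_dist_def i_def j_def)
  finally show ?thesis .
qed

text \<open>The condition \<open>n \<mu> \<ge> 2\<close> guarantees that the segment contains a design point, even after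
  rounding at both ends.\<close>

lemma segment_design_indices:
  fixes a b \<mu> :: real
  assumes "0 \<le> a" "a \<le> b" "b \<le> 1" "b - a \<ge> \<mu>" "real n * \<mu> \<ge> 2"
  obtains p q where "(p, q) \<in> index_pairs n"
    and "\<And>l. l \<in> {1..n} \<Longrightarrow> design n l \<in> {a..b} \<longleftrightarrow> l \<in> {p..q}"
    and "\<bar>real n * a - real p\<bar> \<le> 1" and "\<bar>real n * b - real q\<bar> \<le> 1"
    and "real q - real p + 1 \<ge> real n * \<mu> - 1"
proof -
  \<comment> \<open>Design indices start at \<open>1\<close>, hence the maximum in the case \<open>a = 0\<close>.\<close>
  define p where "p = max 1 (nat \<lceil>real n * a\<rceil>)"
  define q where "q = nat \<lfloor>real n * b\<rfloor>"
  have "n > 0"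
    using assms by (cases n) auto
  have na: "0 \<le> real n * a" and nb: "0 \<le> real n * b" "real n * b \<le> real n"
    using assms by (auto intro: mult_left_le)
  have p: "real n * a \<le> real p" "real p \<le> real n * a + 1"
    using na unfolding p_def by linarith+
  have q: "real q \<le> real n * b" "real n * b \<le> real q + 1"
    using nb unfolding q_def by linarith+
  have gap: "real n * b - real n * a \<ge> real n * \<mu>"
    using mult_left_mono[OF assms(4), of "real n"] by (simp add: right_diff_distrib)
  show thesis
  proof (rule that[of p q])
    show "(p, q) \<in> index_pairs n"
      using p q gap assms(5) nb by (auto simp: index_pairs_def p_def)
    show "design n l \<in> {a..b} \<longleftrightarrow> l \<in> {p..q}" if "l \<in> {1..n}" for l
    proof -
      have "design n l \<in> {a..b} \<longleftrightarrow> real n * a \<le> real l \<and> real l \<le> real n * b"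
        using \<open>n > 0\<close> by (simp add: design_def field_simps)
      also have "real n * a \<le> real l \<longleftrightarrow> p \<le> l"
        using that unfolding p_def by (auto simp: ceiling_le_iff nat_le_iff)
      also have "real l \<le> real n * b \<longleftrightarrow> l \<le> q"
        using nb unfolding q_def by (simp add: le_nat_iff le_floor_iff)
      finally show ?thesis
        by simp
    qed
  qed (use p q gap in auto)
qed

lemma segment_estimator_tail:
  assumes \<nu>: "subgaussian_law \<sigma> \<nu>" and "\<sigma> > 0"
    and G: "G \<in> segments \<mu>" and n: "real n * \<mu> \<ge> 2"
  shows "measure (obs_law n \<nu> G) {z \<in> space (sample_space n).
            measure lebesgue (sym_diff (segment_estimator n z) G) \<ge> x / real n}
         \<le> (2 / (1 - exp (- 1 / (16 * \<sigma>\<^sup>2))))\<^sup>2 * exp (- (x - 2) / (16 * \<sigma>\<^sup>2))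
            + (real n)\<^sup>2 * exp (- (real n * \<mu> - 1) / (8 * \<sigma>\<^sup>2))"
proof -
  obtain a b where ab: "G = {a..b}" "0 \<le> a" "a \<le> b" "b \<le> 1" "b - a \<ge> \<mu>"
    using G by (auto simp: segments_def)
  obtain p q where pq: "(p, q) \<in> index_pairs n"
    and idx: "\<And>l. l \<in> {1..n} \<Longrightarrow> design n l \<in> {a..b} \<longleftrightarrow> l \<in> {p..q}"
    and near: "\<bar>real n * a - real p\<bar> \<le> 1" "\<bar>real n * b - real q\<bar> \<le> 1"
    and len: "real q - real p + 1 \<ge> real n * \<mu> - 1"
    using segment_design_indices[OF ab(2-5) n] by blast
  have "n \<ge> 1"
    using pq by (auto simp: index_pairs_def)
  define N where "N = (\<Pi>\<^sub>M i\<in>{1..n}. \<nu>)"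
  interpret N: prob_space N
    unfolding N_def using \<nu> by (rule subgaussian_law_product_prob_space)
  have obs [measurable]: "observe n G \<in> measurable N (sample_space n)"
    unfolding N_def using \<nu> ab by (intro observe_measurable) (auto simp: subgaussian_law_def)
  have [measurable]: "(\<lambda>z. measure lebesgue (sym_diff (segment_estimator n z) G)) \<in> borel_measurable (sample_space n)"
    using set_estimator_segment_estimator[of n] ab by (auto simp: set_estimator_def)
  have [measurable]: "(\<lambda>\<xi>. index_dist (best_pair n (observe n G \<xi>)) p q) \<in> borel_measurable N"
    by (rule measurable_compose[OF measurable_compose[OF obs measurable_best_pair]]) simp
  have "measure (obs_law n \<nu> G) {z \<in> space (sample_space n).
            measure lebesgue (sym_diff (segment_estimator n z) G) \<ge> x / real n}
      = measure N {\<xi> \<in> space N. measure lebesgue (sym_diff (segment_estimator n (observe n G \<xi>)) G) \<ge> x / real n}"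
    unfolding obs_law_def N_def[symmetric] using measurable_space[OF obs]
    by (subst measure_distr) (auto intro!: arg_cong[where f = "measure N"])
  also have "\<dots> \<le> measure N {\<xi> \<in> space N. index_dist (best_pair n (observe n G \<xi>)) p q \<ge> x - 2}"
  proof (rule N.finite_measure_mono)
    have "x - 2 \<le> index_dist (best_pair n z) p q"
      if "x / real n \<le> measure lebesgue (sym_diff (segment_estimator n z) G)" for z
    proof -
      have "x / real n \<le> (index_dist (best_pair n z) p q + 2) / real n"
        using that measure_sym_diff_segment_estimator_le[OF ab(2,4) \<open>n \<ge> 1\<close> near, of z] ab(1) by simp
      then show ?thesis
        using \<open>n \<ge> 1\<close> by (simp add: divide_le_cancel)
    qed
    then show "{\<xi> \<in> space N. measure lebesgue (sym_diff (segment_estimator n (observe n G \<xi>)) G) \<ge> x / real n}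
        \<subseteq> {\<xi> \<in> space N. index_dist (best_pair n (observe n G \<xi>)) p q \<ge> x - 2}"
      by blast
  qed measurable
  also have "\<dots> \<le> (2 / (1 - exp (- 1 / (16 * \<sigma>\<^sup>2))))\<^sup>2 * exp (- (x - 2) / (16 * \<sigma>\<^sup>2))
            + (real n)\<^sup>2 * exp (- (real q - real p + 1) / (8 * \<sigma>\<^sup>2))"
    unfolding N_def ab(1) by (rule best_pair_dist_tail[OF \<nu> \<open>\<sigma> > 0\<close> pq idx]) auto
  also have "exp (- (real q - real p + 1) / (8 * \<sigma>\<^sup>2)) \<le> exp (- (real n * \<mu> - 1) / (8 * \<sigma>\<^sup>2))"
    using len \<open>\<sigma> > 0\<close> by (simp add: divide_right_mono)
  finally show ?thesis
    by (simp add: mult_left_mono)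
qed

theorem theorem8:
  fixes \<sigma> :: real
  assumes "\<sigma> > 0"
  shows "\<exists>C0 C1 C2 :: real. C0 > 0 \<and> C1 > 0 \<and> C2 > 0 \<and>
    (\<forall>\<mu>::real. 0 < \<mu> \<and> \<mu> < 1 \<longrightarrow>
      (\<exists>T :: nat \<Rightarrow> (nat \<Rightarrow> real \<times> real) \<Rightarrow> real set.
        (\<forall>n. set_estimator n (T n)) \<and>
        (\<forall>\<^sub>F n in sequentially. \<forall>\<nu>. subgaussian_law \<sigma> \<nu> \<longrightarrow> (\<forall>x::real. x > 0 \<longrightarrow>
          (SUP G\<in>segments \<mu>.
             measure (obs_law n \<nu> G)
               {z \<in> space (sample_space n).
                  measure lebesgue (sym_diff (T n z) G) \<ge> x / real n})
          \<le> 2 * C0 * exp (- \<mu> * x / (256 * \<sigma>\<^sup>2))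
            + C1 * real n ^ 4 * exp (- C2 * \<mu> * real n / 2)))))"
proof -
  \<comment> \<open>\<open>K\<close> bounds the product of the two geometric series. \<open>C0\<close> absorbs the shift from \<open>x - 2\<close> to
    \<open>x\<close>, and \<open>C1\<close> the one from \<open>n \<mu> - 1\<close> to \<open>n \<mu>\<close>.\<close>
  define K where "K = (2 / (1 - exp (- 1 / (16 * \<sigma>\<^sup>2))))\<^sup>2"
  define C0 where "C0 = K * exp (1 / (8 * \<sigma>\<^sup>2)) / 2"
  define C1 where "C1 = exp (1 / (8 * \<sigma>\<^sup>2))"
  define C2 where "C2 = 1 / (4 * \<sigma>\<^sup>2)"
  have "K > 0"
    using assms by (auto simp: K_def)
  have tail: "(SUP G\<in>segments \<mu>. measure (obs_law n \<nu> G) {z \<in> space (sample_space n).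
            measure lebesgue (sym_diff (segment_estimator n z) G) \<ge> x / real n})
         \<le> 2 * C0 * exp (- \<mu> * x / (256 * \<sigma>\<^sup>2)) + C1 * real n ^ 4 * exp (- C2 * \<mu> * real n / 2)"
    if \<mu>: "0 < \<mu>" "\<mu> < 1" and \<nu>: "subgaussian_law \<sigma> \<nu>" and "x > 0" and n: "real n * \<mu> \<ge> 2" for \<mu> \<nu> x n
  proof (rule cSUP_least)
    have "{0..1} \<in> segments \<mu>"
      using \<mu> unfolding segments_def by fastforce
    then show "segments \<mu> \<noteq> {}"
      by blast
    fix G assume G: "G \<in> segments \<mu>"
    have "measure (obs_law n \<nu> G) {z \<in> space (sample_space n).
            measure lebesgue (sym_diff (segment_estimator n z) G) \<ge> x / real n}
         \<le> K * exp (- (x - 2) / (16 * \<sigma>\<^sup>2)) + (real n)\<^sup>2 * exp (- (real n * \<mu> - 1) / (8 * \<sigma>\<^sup>2))"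
      unfolding K_def by (rule segment_estimator_tail[OF \<nu> assms G n])
    also have "K * exp (- (x - 2) / (16 * \<sigma>\<^sup>2)) = 2 * C0 * exp (- x / (16 * \<sigma>\<^sup>2))"
      using assms by (simp add: C0_def exp_add[symmetric] field_simps)
    also have "exp (- x / (16 * \<sigma>\<^sup>2)) \<le> exp (- \<mu> * x / (256 * \<sigma>\<^sup>2))"
    proof -
      have "\<mu> * x \<le> 16 * x"
        using \<mu> \<open>x > 0\<close> by (intro mult_right_mono) auto
      then show ?thesis
        using assms by (simp add: field_simps)
    qed
    also have "exp (- (real n * \<mu> - 1) / (8 * \<sigma>\<^sup>2)) = C1 * exp (- C2 * \<mu> * real n / 2)"
      using assms by (simp add: C1_def C2_def exp_add[symmetric] field_simps)
    also have "(real n)\<^sup>2 * (C1 * exp (- C2 * \<mu> * real n / 2)) \<le> real n ^ 4 * (C1 * exp (- C2 * \<mu> * real n / 2))"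
    proof (intro mult_right_mono)
      have "n > 0"
        using n by (cases n) auto
      then show "(real n)\<^sup>2 \<le> real n ^ 4"
        by (intro power_increasing) auto
    qed (simp add: C1_def)
    finally show "measure (obs_law n \<nu> G) {z \<in> space (sample_space n).
            measure lebesgue (sym_diff (segment_estimator n z) G) \<ge> x / real n}
        \<le> 2 * C0 * exp (- \<mu> * x / (256 * \<sigma>\<^sup>2)) + C1 * real n ^ 4 * exp (- C2 * \<mu> * real n / 2)"
      using \<open>K > 0\<close> by (simp add: C0_def mult_ac)
  qed
  have large: "\<forall>\<^sub>F n in sequentially. real n * \<mu> \<ge> 2" if "\<mu> > 0" for \<mu>
    using eventually_ge_at_top[of "nat \<lceil>2 / \<mu>\<rceil>"]
  proof eventually_elim
    case (elim n)
    then have "2 / \<mu> \<le> real n"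
      by linarith
    then show ?case
      using that by (simp add: field_simps)
  qed
  show ?thesis
  proof (rule exI[of _ C0], rule exI[of _ C1], rule exI[of _ C2], intro conjI allI impI)
    show "C0 > 0" "C1 > 0" "C2 > 0"
      using \<open>K > 0\<close> assms by (auto simp: C0_def C1_def C2_def)
    fix \<mu> :: real assume \<mu>: "0 < \<mu> \<and> \<mu> < 1"
    show "\<exists>T. (\<forall>n. set_estimator n (T n)) \<and>
        (\<forall>\<^sub>F n in sequentially. \<forall>\<nu>. subgaussian_law \<sigma> \<nu> \<longrightarrow> (\<forall>x::real. x > 0 \<longrightarrow>
          (SUP G\<in>segments \<mu>.
             measure (obs_law n \<nu> G)
               {z \<in> space (sample_space n).
                  measure lebesgue (sym_diff (T n z) G) \<ge> x / real n})
          \<le> 2 * C0 * exp (- \<mu> * x / (256 * \<sigma>\<^sup>2))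
            + C1 * real n ^ 4 * exp (- C2 * \<mu> * real n / 2)))"
    proof (intro exI[of _ segment_estimator] conjI allI set_estimator_segment_estimator)
      show "\<forall>\<^sub>F n in sequentially. \<forall>\<nu>. subgaussian_law \<sigma> \<nu> \<longrightarrow> (\<forall>x::real. x > 0 \<longrightarrow>
          (SUP G\<in>segments \<mu>.
             measure (obs_law n \<nu> G)
               {z \<in> space (sample_space n).
                  measure lebesgue (sym_diff (segment_estimator n z) G) \<ge> x / real n})
          \<le> 2 * C0 * exp (- \<mu> * x / (256 * \<sigma>\<^sup>2))
            + C1 * real n ^ 4 * exp (- C2 * \<mu> * real n / 2))"
        using large[OF conjunct1[OF \<mu>]] by (rule eventually_mono) (use \<mu> tail in blast)
    qed
  qed
qed

end
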